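(* Let $n\geq 2$ and let $\Lambda_n:\mathbb{R}^n\to(0,\infty)$ be defined by $\Lambda_n(x)=\exp\left(-x_1-\pi\sum_{i=2}^{n}x_i^2\right)$. Then for all $y\in\mathbb{R}^n$ there exists an invertible $n\times n$ real matrix $T$ with the following property: for all $x\in\mathbb{R}^n$, $$\frac{\Lambda_n(y+Tx)}{\Lambda_n(y)}=\Lambda_n(x).$$ *)

theory Defs
  imports Complex_Main "Jordan_Normal_Form.Matrix"
begin

text \<open>Points of \<open>\<real>\<^sup>n\<close> are the vectors in \<open>carrier_vec n\<close>, whose components are indexed from 0:
  the coordinate \<open>x\<^sub>i\<close> is \<open>x $ (i - 1)\<close>.\<close>

definition Lambda :: "nat \<Rightarrow> real vec \<Rightarrow> real" where
  "Lambda n x = exp (- (x $ 0) - pi * (\<Sum>i = 2..n. (x $ (i - 1))\<^sup>2))"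

lemma Lambda_pos: "Lambda n x > 0"
  by (simp add: Lambda_def)

end

theory Submission
  imports Defs "Jordan_Normal_Form.Determinant"
begin

text \<open>Expanding \<open>(y\<^sub>i + x\<^sub>i)\<^sup>2\<close>, the only terms that prevent \<open>\<Lambda>\<^sub>n(y + x) = \<Lambda>\<^sub>n(y) \<Lambda>\<^sub>n(x)\<close> are the
  cross terms \<open>2 \<pi> y\<^sub>i x\<^sub>i\<close> in the exponent. They are linear in \<open>x\<close>, so a shear in the first
  coordinate, in which the exponent is also linear, absorbs them.\<close>

definition shear_mat :: "nat \<Rightarrow> real vec \<Rightarrow> real mat" where
  "shear_mat n y = mat n n (\<lambda>(i, j). if i = j then 1 else if i = 0 then - 2 * pi * y $ j else 0)"

lemma shear_mat_carrier [simp]: "shear_mat n y \<in> carrier_mat n n"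
  by (simp add: shear_mat_def)

text \<open>Off-diagonal entries can be nonzero only in row 0, hence above the diagonal, and the
  diagonal consists of ones.\<close>

lemma det_shear_mat: "det (shear_mat n y) = 1"
proof -
  have "upper_triangular (shear_mat n y)"
    by (auto simp: shear_mat_def)
  then have "det (shear_mat n y) = prod_list (diag_mat (shear_mat n y))"
    by (rule det_upper_triangular) (rule shear_mat_carrier)
  also have "diag_mat (shear_mat n y) = replicate n 1"
    by (rule nth_equalityI) (auto simp: diag_mat_def shear_mat_def)
  finally show ?thesis
    by simp
qed

lemma invertible_shear_mat: "invertible_mat (shear_mat n y)"
proof -
  \<comment> \<open>A nonzero determinant makes the matrix a unit of the matrix ring, which yields a
    two-sided inverse; \<open>UNIV\<close> merely fills the extension slot of the record
    \<open>ring_mat\<close>.\<close>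
  obtain B where "B \<in> carrier_mat n n" "shear_mat n y * B = 1\<^sub>m n" "B * shear_mat n y = 1\<^sub>m n"
    using det_non_zero_imp_unit[OF shear_mat_carrier, of n y UNIV] det_shear_mat[of n y]
    by (auto simp: Units_def ring_mat_def)
  then show ?thesis
    unfolding invertible_mat_def inverts_mat_def
    by (intro conjI exI[of _ B]) (auto simp: shear_mat_def)
qed

lemma shear_mat_mult_vec:
  assumes "x \<in> carrier_vec n" "i < n"
  shows "(shear_mat n y *\<^sub>v x) $ i =
    (if i = 0 then x $ 0 - 2 * pi * (\<Sum>j = 1..<n. y $ j * x $ j) else x $ i)"
proof -
  have "(shear_mat n y *\<^sub>v x) $ i = (\<Sum>j = 0..<n. shear_mat n y $$ (i, j) * x $ j)"
    using assms by (simp add: shear_mat_def scalar_prod_def)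
  also have "\<dots> = (if i = 0 then x $ 0 - 2 * pi * (\<Sum>j = 1..<n. y $ j * x $ j) else x $ i)"
  proof (cases "i = 0")
    case True
    \<comment> \<open>The diagonal entry 1 is split off, so that every remaining entry of row 0 is
      given by the shear coefficient.\<close>
    have "(\<Sum>j = 0..<n. shear_mat n y $$ (i, j) * x $ j) =
        x $ 0 + (\<Sum>j = 1..<n. shear_mat n y $$ (i, j) * x $ j)"
      using assms True by (simp add: sum.atLeast_Suc_lessThan shear_mat_def)
    also have "(\<Sum>j = 1..<n. shear_mat n y $$ (i, j) * x $ j) =
        (\<Sum>j = 1..<n. - 2 * pi * (y $ j * x $ j))"
      using assms True by (intro sum.cong) (auto simp: shear_mat_def)
    finally show ?thesis
      using True by (simp add: sum_distrib_left sum_negf)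
  next
    case False
    have "(\<Sum>j = 0..<n. shear_mat n y $$ (i, j) * x $ j) =
        (\<Sum>j = 0..<n. if i = j then x $ j else 0)"
      using assms False by (intro sum.cong) (auto simp: shear_mat_def)
    then show ?thesis
      using assms False by simp
  qed
  finally show ?thesis .
qed

text \<open>Shifting to 0-based indices puts the squares over the same range as the cross terms in
  \<open>shear_mat_mult_vec\<close>.\<close>

lemma Lambda_altdef: "Lambda n x = exp (- (x $ 0) - pi * (\<Sum>j = 1..<n. (x $ j)\<^sup>2))"
proof -
  have "(\<Sum>i = 2..n. (x $ (i - 1))\<^sup>2) = (\<Sum>j = 1..<n. (x $ j)\<^sup>2)"
    by (rule sum.reindex_bij_witness[of _ Suc "\<lambda>i. i - 1"]) auto
  then show ?thesis
    by (simp add: Lambda_def)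
qed

text \<open>With S the sum of the \<open>y $ j * x $ j\<close> over j from 1 to n - 1, expanding the
  squares adds -2 pi S to the exponent, while coordinate 0, lowered by 2 pi S and entering with a
  minus sign, adds +2 pi S.\<close>

lemma Lambda_shear_mat:
  assumes "0 < n" "y \<in> carrier_vec n" "x \<in> carrier_vec n"
  shows "Lambda n (y + shear_mat n y *\<^sub>v x) = Lambda n y * Lambda n x"
proof -
  define z where "z = y + shear_mat n y *\<^sub>v x"
  have dim: "dim_vec (shear_mat n y *\<^sub>v x) = n"
    by (simp add: shear_mat_def)
  \<comment> \<open>Deleting \<open>index_mult_mat_vec\<close> keeps the simplifier from unfolding
    the component into a scalar product before \<open>shear_mat_mult_vec\<close> can apply.\<close>
  have z0: "z $ 0 = y $ 0 + x $ 0 - 2 * pi * (\<Sum>j = 1..<n. y $ j * x $ j)"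
    using assms dim by (simp add: z_def shear_mat_mult_vec del: index_mult_mat_vec)
  have "(\<Sum>j = 1..<n. (z $ j)\<^sup>2) = (\<Sum>j = 1..<n. (y $ j)\<^sup>2 + (x $ j)\<^sup>2 + 2 * (y $ j * x $ j))"
    using assms dim
    by (intro sum.cong)
      (auto simp: z_def shear_mat_mult_vec power2_sum simp del: index_mult_mat_vec)
  also have "\<dots> = (\<Sum>j = 1..<n. (y $ j)\<^sup>2) + (\<Sum>j = 1..<n. (x $ j)\<^sup>2)
      + 2 * (\<Sum>j = 1..<n. y $ j * x $ j)"
    by (simp add: sum.distrib sum_distrib_left)
  finally have "Lambda n z = Lambda n y * Lambda n x"
    by (simp add: Lambda_altdef z0 algebra_simps flip: exp_add)
  then show ?thesis
    by (simp add: z_def)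
qed

theorem theorem11:
  fixes n :: nat
  assumes "n \<ge> 2"
  shows "\<forall>y \<in> carrier_vec n. \<exists>T \<in> carrier_mat n n. invertible_mat T \<and>
           (\<forall>x \<in> carrier_vec n. Lambda n (y + T *\<^sub>v x) / Lambda n y = Lambda n x)"
proof
  fix y :: "real vec"
  assume "y \<in> carrier_vec n"
  \<comment> \<open>Positivity of \<open>Lambda n y\<close> turns the product identity into the
    quotient form.\<close>
  then have "Lambda n (y + shear_mat n y *\<^sub>v x) / Lambda n y = Lambda n x"
    if "x \<in> carrier_vec n" for x
    using assms that Lambda_pos[of n y] by (simp add: Lambda_shear_mat)
  then show "\<exists>T \<in> carrier_mat n n. invertible_mat T \<and>
      (\<forall>x \<in> carrier_vec n. Lambda n (y + T *\<^sub>v x) / Lambda n y = Lambda n x)"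
    using invertible_shear_mat shear_mat_carrier by blast
qed

end
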